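(* Consider a smoothed online combinatorial optimization problem with cost function $f:\mathcal{X}\times\Theta\to\mathbb{R}_{\ge0}$ and metric $d:\mathcal{X}\times\mathcal{X}\to\mathbb{R}_{\ge0}$. Suppose $f(x,\theta)$ is Lipschitz in $\theta\in\Theta$ with Lipschitz constant $L$, i.e. $\left\|\frac{\partial f(x,\theta)}{\partial\theta}\right\|\le L$ for all $x\in\mathcal{X}$, $\theta\in\Theta$, and suppose the switching cost is bounded on $\mathcal{X}$ by $B=\sup_{x,y\in\mathcal{X}}d(x,y)$, the maximal switching cost. Let a predictive model with predictions $\theta^{(t)}_s$ and uncertainties $\epsilon^{(t)}_s$ be given, as described in the context. Then, in $T$ time steps, the Dynamic Future Planning algorithm achieves cumulative dynamic regret $$\mathrm{Reg}_T\le 2BI,$$ where $I$ is the total number of planning windows used by the algorithm.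
   Context: Setting. $\mathcal{X}$ is the (combinatorial) set of feasible decisions and $\Theta$ is the set of possible parameters, in a normed space. There is a sequence of true parameters $\theta_1,\theta_2,\dots\in\Theta$. At each time $t$ the learner receives a feature $\xi_t$ correlated with the future parameters and chooses $x_t\in\mathcal{X}$ before $\theta_t$ is revealed; it then pays $f(x_t,\theta_t)+d(x_t,x_{t-1})$, where $x_0$ is the initial decision. The cost of an online algorithm is $\mathrm{cost}_T(\mathrm{ALG})=\sum_{t=1}^T \big(f(x_t,\theta_t)+d(x_t,x_{t-1})\big)$. The offline optimum, which knows all parameters in advance, has cost $\mathrm{cost}_T(\mathrm{OPT})=\min_{y_1,\dots,y_T\in\mathcal{X}}\sum_{t=1}^T \big(f(y_t,\theta_t)+d(y_t,y_{t-1})\big)$ with $y_0=x_0$. The dynamic regret is $\mathrm{Reg}_T=\mathrm{cost}_T(\mathrm{ALG})-\mathrm{cost}_T(\mathrm{OPT})$. Predictions. At each time $t$ the predictive model, trained on the parameters revealed before time $t$, takes the feature $\xi_t$ and produces predictions $\theta^{(t)}_s$ with uncertainties $\epsilon^{(t)}_s$ for all integers $s\ge t$, where $\|\theta_s-\theta^{(t)}_s\|\le\epsilon^{(t)}_s$. The uncertainty $\epsilon^{(t)}_s$ is (weakly) increasing in $s$ and (weakly) decreasing in $t$. Dynamic Future Planning algorithm. Input: the number of time steps $T$, the maximal switching cost $B$, and the predictive model. Start with $t=1$, $I=0$. While $t\le T$: obtain the predictions $\{\theta^{(t)}_s\}_{s\ge t}$ and uncertainties $\{\epsilon^{(t)}_s\}_{s\ge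 t}$; find the largest $S$ such that $2L\sum_{s=t}^{t+S-1}\epsilon^{(t)}_s\le B$; let $(x_s)_{s=t}^{t+S-1}$ be a minimizer, over decisions in $\mathcal{X}$, of $\sum_{s=t}^{t+S-1} \big(f(x_s,\theta^{(t)}_s)+d(x_s,x_{s-1})\big)$, where $x_{t-1}$ is the decision already taken at time $t-1$; execute $x_s$, receive $\theta_s$ and pay $f(x_s,\theta_s)+d(x_s,x_{s-1})$ at times $s=t,\dots,t+S-1$; then replace $t$ by $t+S$ and $I$ by $I+1$. Each pass through the loop is one planning window. *)

theory Defs
  imports "HOL-Analysis.Analysis"
begin

text \<open>
  A trajectory is a function \<open>x :: nat \<Rightarrow> 'x\<close>: \<open>x 0\<close> is the initial decision and \<open>x t\<close> the
  decision at time \<open>t \<ge> 1\<close>. Parameters, predictions and uncertainties are likewise indexed by times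
  \<open>\<ge> 1\<close>: \<open>pred t s\<close> and \<open>eps t s\<close> are the prediction of the parameter at time \<open>s\<close> and its
  uncertainty, both produced at time \<open>t \<le> s\<close>.
\<close>

definition window_cost ::
  "('x \<Rightarrow> 'p \<Rightarrow> real) \<Rightarrow> ('x \<Rightarrow> 'x \<Rightarrow> real) \<Rightarrow> (nat \<Rightarrow> 'p) \<Rightarrow> nat \<Rightarrow> nat \<Rightarrow> (nat \<Rightarrow> 'x) \<Rightarrow> real"
  where "window_cost f d \<theta> t S x = (\<Sum>s=t..<t+S. f (x s) (\<theta> s) + d (x s) (x (s - 1)))"

abbreviation total_cost ::
  "('x \<Rightarrow> 'p \<Rightarrow> real) \<Rightarrow> ('x \<Rightarrow> 'x \<Rightarrow> real) \<Rightarrow> (nat \<Rightarrow> 'p) \<Rightarrow> nat \<Rightarrow> (nat \<Rightarrow> 'x) \<Rightarrow> real"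
  where "total_cost f d \<theta> T x \<equiv> window_cost f d \<theta> 1 T x"

text \<open>
  The offline optimum is an infimum, so that \<open>X\<close> need not be finite; it is the minimum whenever the
  minimum is attained.
\<close>

definition opt_cost ::
  "'x set \<Rightarrow> ('x \<Rightarrow> 'p \<Rightarrow> real) \<Rightarrow> ('x \<Rightarrow> 'x \<Rightarrow> real) \<Rightarrow> (nat \<Rightarrow> 'p) \<Rightarrow> 'x \<Rightarrow> nat \<Rightarrow> real"
  where "opt_cost X f d \<theta> x0 T =
    (INF y\<in>{y. y 0 = x0 \<and> (\<forall>t\<in>{1..T}. y t \<in> X)}. total_cost f d \<theta> T y)"

definition regret ::
  "'x set \<Rightarrow> ('x \<Rightarrow> 'p \<Rightarrow> real) \<Rightarrow> ('x \<Rightarrow> 'x \<Rightarrow> real) \<Rightarrow> (nat \<Rightarrow> 'p) \<Rightarrow> nat \<Rightarrow> (nat \<Rightarrow> 'x) \<Rightarrow> real"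
  where "regret X f d \<theta> T x = total_cost f d \<theta> T x - opt_cost X f d \<theta> (x 0) T"

definition within_budget ::
  "real \<Rightarrow> real \<Rightarrow> (nat \<Rightarrow> nat \<Rightarrow> real) \<Rightarrow> nat \<Rightarrow> nat \<Rightarrow> bool"
  where "within_budget L B eps t S \<longleftrightarrow> 2 * L * (\<Sum>s=t..<t+S. eps t s) \<le> B"

text \<open>
  The window length is the largest one within budget. This maximum may exceed the remaining horizon,
  and it does not exist if all lengths are within budget (for instance for exact predictions).
  Therefore a window that can reach the final time \<open>T\<close> within budget may alternatively stop exactly
  there. If the maximum exists and the window ends before \<open>T\<close>, the length is forced.
\<close>

definition planning_length ::
  "nat \<Rightarrow> real \<Rightarrow> real \<Rightarrow> (nat \<Rightarrow> nat \<Rightarrow> real) \<Rightarrow> nat \<Rightarrow> nat \<Rightarrow> bool"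
  where "planning_length T L B eps t S \<longleftrightarrow>
    within_budget L B eps t S \<and>
    ((\<forall>S'. within_budget L B eps t S' \<longrightarrow> S' \<le> S) \<or> t + S = T + 1)"

definition optimal_plan ::
  "'x set \<Rightarrow> ('x \<Rightarrow> 'p \<Rightarrow> real) \<Rightarrow> ('x \<Rightarrow> 'x \<Rightarrow> real) \<Rightarrow> (nat \<Rightarrow> 'p) \<Rightarrow> nat \<Rightarrow> nat \<Rightarrow> (nat \<Rightarrow> 'x) \<Rightarrow> bool"
  where "optimal_plan X f d \<theta> t S x \<longleftrightarrow>
    is_arg_min (window_cost f d \<theta> t S)
      (\<lambda>y. y (t - 1) = x (t - 1) \<and> (\<forall>s\<in>{t..<t+S}. y s \<in> X)) x"

text \<open>
  \<open>dfp_state X f d T L B pred eps x t I\<close>: the loop of Dynamic Future Planning can reach time counter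
  \<open>t\<close> and window counter \<open>I\<close> while producing the decisions \<open>x\<close>. A terminated run is a state
  with \<open>T < t\<close>. A window of length 0 does not advance \<open>t\<close>, so an instance in which not even one
  step is within budget has no terminated run. A window may extend beyond \<open>T\<close>; its decisions
  after time \<open>T\<close> do not enter \<open>regret\<close>.
\<close>

inductive dfp_state ::
  "'x set \<Rightarrow> ('x \<Rightarrow> 'p \<Rightarrow> real) \<Rightarrow> ('x \<Rightarrow> 'x \<Rightarrow> real) \<Rightarrow> nat \<Rightarrow> real \<Rightarrow> real \<Rightarrow>
   (nat \<Rightarrow> nat \<Rightarrow> 'p) \<Rightarrow> (nat \<Rightarrow> nat \<Rightarrow> real) \<Rightarrow> (nat \<Rightarrow> 'x) \<Rightarrow> nat \<Rightarrow> nat \<Rightarrow> bool"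
  for X f d T L B pred eps x
  where
    init: "dfp_state X f d T L B pred eps x 1 0"
  | window: "\<lbrakk>dfp_state X f d T L B pred eps x t I; t \<le> T;
      planning_length T L B eps t S; optimal_plan X f d (pred t) t S x\<rbrakk>
      \<Longrightarrow> dfp_state X f d T L B pred eps x (t + S) (Suc I)"

end

theory Submission imports Defs begin

text \<open>
  Fix a competitor with decisions \<open>y\<close>. In each window, planning with predictions instead of true
  parameters costs at most \<open>2 L\<close> times the total uncertainty, hence at most \<open>B\<close>, and letting the
  competitor start from the algorithm's decision costs at most another \<open>B\<close>. In the first window
  both start from the same decision, so \<open>I\<close> windows lose only \<open>(2 I - 1) B\<close>. The \<open>B\<close> that is
  left over pays for a last window that runs beyond \<open>T\<close>: there the competitor is continued by the
  algorithm's own decisions, at the price of one additional switch.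
\<close>

lemma window_cost_add:
  "window_cost f d \<theta> t (S + S') x = window_cost f d \<theta> t S x + window_cost f d \<theta> (t + S) S' x"
  unfolding window_cost_def by (simp add: sum.atLeastLessThan_concat flip: add.assoc)

text \<open>Only the first switching cost sees the starting decision, so the triangle inequality at
  time \<open>t\<close> suffices; an empty window leaves just the nonnegativity of
  \<open>d\<close>.\<close>

lemma window_cost_change_start:
  assumes "Metric_space X d" and t: "1 \<le> t"
    and xX: "\<And>s. t - 1 \<le> s \<Longrightarrow> s < t + S \<Longrightarrow> x s \<in> X" and x'X: "x' (t - 1) \<in> X"
    and eq: "\<And>s. t \<le> s \<Longrightarrow> s < t + S \<Longrightarrow> x' s = x s"
  shows "window_cost f d \<theta> t S x' \<le> window_cost f d \<theta> t S x + d (x' (t - 1)) (x (t - 1))"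
proof (cases S)
  case 0
  interpret Metric_space X d by fact
  show ?thesis using 0 by (simp add: window_cost_def)
next
  case (Suc R)
  interpret Metric_space X d by fact
  have split: "window_cost f d \<theta> t S y =
      f (y t) (\<theta> t) + d (y t) (y (t - 1)) + window_cost f d \<theta> (Suc t) R y" for y
    using window_cost_add[of f d \<theta> t 1 R y] Suc by (simp add: window_cost_def)
  have "window_cost f d \<theta> (Suc t) R x' = window_cost f d \<theta> (Suc t) R x"
    unfolding window_cost_def using eq Suc by (intro sum.cong) auto
  moreover have "x' t = x t" using eq Suc by simp
  moreover have "d (x t) (x' (t - 1)) \<le> d (x t) (x (t - 1)) + d (x' (t - 1)) (x (t - 1))"
    using triangle[of "x t" "x (t - 1)" "x' (t - 1)"]
      xX[of t] xX[of "t - 1"] x'X t Suc commute by simp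
  ultimately show ?thesis by (simp add: split)
qed

text \<open>Switching costs do not depend on the parameters and cancel in the difference; the
  Lipschitz bound then applies term by term.\<close>

lemma window_cost_lipschitz:
  fixes \<theta> \<theta>' :: "nat \<Rightarrow> 'p::real_normed_vector"
  assumes lip: "\<And>a. a \<in> X \<Longrightarrow> L-lipschitz_on \<Theta> (f a)"
    and xX: "\<And>s. t \<le> s \<Longrightarrow> s < t + S \<Longrightarrow> x s \<in> X"
    and param: "\<And>s. t \<le> s \<Longrightarrow> \<theta> s \<in> \<Theta>" "\<And>s. t \<le> s \<Longrightarrow> \<theta>' s \<in> \<Theta>"
    and err: "\<And>s. t \<le> s \<Longrightarrow> norm (\<theta> s - \<theta>' s) \<le> e s"
  shows "\<bar>window_cost f d \<theta> t S x - window_cost f d \<theta>' t S x\<bar> \<le> L * (\<Sum>s=t..<t+S. e s)"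
proof -
  have "\<bar>window_cost f d \<theta> t S x - window_cost f d \<theta>' t S x\<bar>
      = \<bar>\<Sum>s=t..<t+S. f (x s) (\<theta> s) - f (x s) (\<theta>' s)\<bar>"
    unfolding window_cost_def by (simp flip: sum_subtractf)
  also have "\<dots> \<le> (\<Sum>s=t..<t+S. L * e s)"
  proof (rule sum_norm_le[where 'a=real, unfolded real_norm_def])
    fix s assume s: "s \<in> {t..<t+S}"
    have l: "L-lipschitz_on \<Theta> (f (x s))" using lip xX s by simp
    have "\<bar>f (x s) (\<theta> s) - f (x s) (\<theta>' s)\<bar> \<le> L * norm (\<theta> s - \<theta>' s)"
      using lipschitz_onD[OF l, of "\<theta> s" "\<theta>' s"] param s by (simp add: dist_norm)
    also have "\<dots> \<le> L * e s"
      using err s lipschitz_on_nonneg[OF l] by (intro mult_left_mono) auto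
    finally show "\<bar>f (x s) (\<theta> s) - f (x s) (\<theta>' s)\<bar> \<le> L * e s" .
  qed
  finally show ?thesis by (simp add: sum_distrib_left)
qed

text \<open>Optimality holds only for the predicted parameters, so both \<open>x\<close> and
  \<open>z\<close> are transferred between \<theta> and \<theta>'. Each transfer costs
  \<open>L\<close> times the total uncertainty, whence the factor 2.\<close>

lemma optimal_plan_window_regret:
  fixes \<theta> \<theta>' :: "nat \<Rightarrow> 'p::real_normed_vector"
  assumes metric: "Metric_space X d" and t: "1 \<le> t"
    and lip: "\<And>a. a \<in> X \<Longrightarrow> L-lipschitz_on \<Theta> (f a)"
    and param: "\<And>s. t \<le> s \<Longrightarrow> \<theta> s \<in> \<Theta>" "\<And>s. t \<le> s \<Longrightarrow> \<theta>' s \<in> \<Theta>"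
    and err: "\<And>s. t \<le> s \<Longrightarrow> norm (\<theta> s - \<theta>' s) \<le> e s"
    and plan: "optimal_plan X f d \<theta>' t S x"
    and xX: "x (t - 1) \<in> X" and zX: "\<And>s. t - 1 \<le> s \<Longrightarrow> s < t + S \<Longrightarrow> z s \<in> X"
  shows "window_cost f d \<theta> t S x
    \<le> window_cost f d \<theta> t S z + d (x (t - 1)) (z (t - 1)) + 2 * L * (\<Sum>s=t..<t+S. e s)"
proof -
  \<comment> \<open>\<open>z\<close> may enter the window from another decision and so need not
    compete with the plan. Overriding time \<open>t - 1\<close>, which precedes the window since
    \<open>1 \<le> t\<close>, makes it admissible.\<close>
  let ?w = "z(t - 1 := x (t - 1))"
  have xs: "x s \<in> X" if "t \<le> s" "s < t + S" for s
    using plan that unfolding optimal_plan_def is_arg_min_def by auto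
  have "\<forall>s\<in>{t..<t+S}. ?w s \<in> X" using zX t by auto
  then have "window_cost f d \<theta>' t S x \<le> window_cost f d \<theta>' t S ?w"
    using plan unfolding optimal_plan_def is_arg_min_def by (metis fun_upd_same not_less)
  also have "\<dots> \<le> window_cost f d \<theta>' t S z + d (?w (t - 1)) (z (t - 1))"
    by (rule window_cost_change_start[OF metric t]) (use zX xX t in auto)
  finally have "window_cost f d \<theta>' t S x
    \<le> window_cost f d \<theta>' t S z + d (x (t - 1)) (z (t - 1))" by simp
  moreover have "\<bar>window_cost f d \<theta> t S x - window_cost f d \<theta>' t S x\<bar> \<le> L * (\<Sum>s=t..<t+S. e s)"
    by (rule window_cost_lipschitz[OF lip]) (use xs param err in auto)
  moreover have "\<bar>window_cost f d \<theta> t S z - window_cost f d \<theta>' t S z\<bar> \<le> L * (\<Sum>s=t..<t+S. e s)"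
    by (rule window_cost_lipschitz[OF lip]) (use zX param err in auto)
  ultimately show ?thesis by linarith
qed

lemma dfp_state_time_pos: "dfp_state X f d T L B pred eps x t I \<Longrightarrow> 1 \<le> t"
  by (induction rule: dfp_state.induct) auto

lemma dfp_state_feasible:
  assumes "dfp_state X f d T L B pred eps x t I" "x 0 \<in> X" "s < t"
  shows "x s \<in> X"
  using assms
proof (induction arbitrary: s rule: dfp_state.induct)
  case (window t I S)
  then show ?case
    by (cases "s < t") (auto simp: optimal_plan_def is_arg_min_def)
qed simp

text \<open>Loop invariant by induction on the run. The initial state is a separate alternative:
  there both costs are 0, while \<open>(2 * real I - 1) * B\<close> would be
  \<open>- B\<close>.\<close>

lemma dfp_state_cost_le:
  fixes \<theta> :: "nat \<Rightarrow> 'p::real_normed_vector"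
  assumes run: "dfp_state X f d T L B pred eps x t I" and metric: "Metric_space X d"
    and lip: "\<And>a. a \<in> X \<Longrightarrow> L-lipschitz_on \<Theta> (f a)"
    and diam: "\<And>a b. a \<in> X \<Longrightarrow> b \<in> X \<Longrightarrow> d a b \<le> B"
    and true_param: "\<And>s. 1 \<le> s \<Longrightarrow> \<theta> s \<in> \<Theta>"
    and pred_param: "\<And>t s. 1 \<le> t \<Longrightarrow> t \<le> s \<Longrightarrow> pred t s \<in> \<Theta>"
    and pred_error: "\<And>t s. 1 \<le> t \<Longrightarrow> t \<le> s \<Longrightarrow> norm (\<theta> s - pred t s) \<le> eps t s"
    and initial: "x 0 \<in> X" "z 0 = x 0" and zX: "\<And>s. s < t \<Longrightarrow> z s \<in> X"
  shows "t = 1 \<and> I = 0 \<or>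
    window_cost f d \<theta> 1 (t - 1) x \<le> window_cost f d \<theta> 1 (t - 1) z + (2 * real I - 1) * B"
  using run zX
proof (induction rule: dfp_state.induct)
  case (window t I S)
  interpret Metric_space X d by fact
  have t: "1 \<le> t" using dfp_state_time_pos[OF window.hyps(1)] .
  have xt: "x (t - 1) \<in> X" using dfp_state_feasible[OF window.hyps(1) initial(1)] t by simp
  have "2 * L * (\<Sum>s=t..<t+S. eps t s) \<le> B"
    using window.hyps(3) unfolding planning_length_def within_budget_def by simp
  moreover have "window_cost f d \<theta> t S x \<le> window_cost f d \<theta> t S z
      + d (x (t - 1)) (z (t - 1)) + 2 * L * (\<Sum>s=t..<t+S. eps t s)"
    by (rule optimal_plan_window_regret[OF metric t lip _ _ _ window.hyps(4)])
      (use t true_param pred_param pred_error xt window.prems in auto)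
  \<comment> \<open>The switch between the two decisions raises \<open>2 * real I - 1\<close> to
    \<open>2 * real I\<close>, and it is free at the start, where they coincide. The prediction
    error adds the last \<open>B\<close>, giving the coefficient for \<open>Suc I\<close>.\<close>
  moreover have "window_cost f d \<theta> 1 (t - 1) x + d (x (t - 1)) (z (t - 1))
      \<le> window_cost f d \<theta> 1 (t - 1) z + 2 * real I * B"
  proof (cases "t = 1 \<and> I = 0")
    case True
    then show ?thesis using initial by (simp add: window_cost_def)
  next
    case False
    moreover have "d (x (t - 1)) (z (t - 1)) \<le> B" using diam xt window.prems t by simp
    ultimately show ?thesis
      using window.IH window.prems by (auto simp: algebra_simps)
  qed
  moreover have "window_cost f d \<theta> 1 (t + S - 1) y
      = window_cost f d \<theta> 1 (t - 1) y + window_cost f d \<theta> t S y" for y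
    using window_cost_add[of f d \<theta> 1 "t - 1" S y] t by simp
  ultimately show ?case by (simp add: algebra_simps)
qed simp

theorem theorem3p5:
  fixes X :: "'x set" and \<Theta> :: "'p::real_normed_vector set"
    and f :: "'x \<Rightarrow> 'p \<Rightarrow> real" and d :: "'x \<Rightarrow> 'x \<Rightarrow> real"
    and L B :: real and T I t_end :: nat
    and \<theta> :: "nat \<Rightarrow> 'p" and pred :: "nat \<Rightarrow> nat \<Rightarrow> 'p" and eps :: "nat \<Rightarrow> nat \<Rightarrow> real"
    and x :: "nat \<Rightarrow> 'x"
  assumes metric: "Metric_space X d"
    and f_nonneg: "\<And>a p. a \<in> X \<Longrightarrow> p \<in> \<Theta> \<Longrightarrow> 0 \<le> f a p"
    and f_lipschitz: "\<And>a. a \<in> X \<Longrightarrow> L-lipschitz_on \<Theta> (f a)"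
    and d_bounded: "bdd_above ((\<lambda>(a, b). d a b) ` (X \<times> X))"
    and B: "B = (SUP (a, b)\<in>X \<times> X. d a b)"
    and true_param: "\<And>s. 1 \<le> s \<Longrightarrow> \<theta> s \<in> \<Theta>"
    and pred_param: "\<And>t s. 1 \<le> t \<Longrightarrow> t \<le> s \<Longrightarrow> pred t s \<in> \<Theta>"
    and pred_error: "\<And>t s. 1 \<le> t \<Longrightarrow> t \<le> s \<Longrightarrow> norm (\<theta> s - pred t s) \<le> eps t s"
    and eps_incr: "\<And>t s s'. 1 \<le> t \<Longrightarrow> t \<le> s \<Longrightarrow> s \<le> s' \<Longrightarrow> eps t s \<le> eps t s'"
    and eps_decr: "\<And>t t' s. 1 \<le> t \<Longrightarrow> t \<le> t' \<Longrightarrow> t' \<le> s \<Longrightarrow> eps t' s \<le> eps t s"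
    and initial: "x 0 \<in> X"
    and run: "dfp_state X f d T L B pred eps x t_end I"
    and terminated: "T < t_end"
  shows "regret X f d \<theta> T x \<le> 2 * B * real I"
proof -
  have diam: "d a b \<le> B" if "a \<in> X" "b \<in> X" for a b
    unfolding B using cSUP_upper[OF _ d_bounded, of "(a, b)"] that by simp
  have xX: "x s \<in> X" if "s < t_end" for s
    using dfp_state_feasible[OF run initial that] .
  have "total_cost f d \<theta> T x - 2 * B * real I \<le> total_cost f d \<theta> T y"
    if y0: "y 0 = x 0" and yX: "\<forall>t\<in>{1..T}. y t \<in> X" for y
  proof -
    \<comment> \<open>The invariant compares costs up to \<open>t_end - 1\<close>, possibly beyond
      \<open>T\<close>, where \<open>y\<close> is unconstrained. Copying \<open>x\<close> there
      keeps the competitor feasible.\<close>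
    define z where "z s = (if s \<le> T then y s else x s)" for s
    have zX: "z s \<in> X" if "s < t_end" for s
      using y0 yX xX that initial by (cases "s = 0") (auto simp: z_def)
    have z0: "z 0 = x 0" by (simp add: z_def y0)
    have "t_end = 1 \<and> I = 0 \<or> window_cost f d \<theta> 1 (t_end - 1) x
        \<le> window_cost f d \<theta> 1 (t_end - 1) z + (2 * real I - 1) * B"
      by (rule dfp_state_cost_le[where \<Theta> = \<Theta>])
        (fact run metric f_lipschitz diam true_param pred_param pred_error initial z0 zX)+
    then consider (start) "t_end = 1" "I = 0" |
      (later) "window_cost f d \<theta> 1 (t_end - 1) x
        \<le> window_cost f d \<theta> 1 (t_end - 1) z + (2 * real I - 1) * B"
      by blast
    then show ?thesis
    proof cases
      \<comment> \<open>Here \<open>T < t_end\<close> forces \<open>T = 0\<close>, so both costs are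
        empty sums.\<close>
      case start
      then show ?thesis using terminated by (simp add: window_cost_def)
    next
      case later
      \<comment> \<open>The overrun: over these \<open>R\<close> steps \<open>z\<close> and
        \<open>x\<close> agree, and their costs can differ only in the switch from time
        \<open>T\<close>.\<close>
      define R where "R = t_end - 1 - T"
      have split: "window_cost f d \<theta> 1 (t_end - 1) w
          = total_cost f d \<theta> T w + window_cost f d \<theta> (T + 1) R w" for w
        using window_cost_add[of f d \<theta> 1 T R w] terminated by (simp add: R_def)
      have "window_cost f d \<theta> (T + 1) R z
          \<le> window_cost f d \<theta> (T + 1) R x + d (z (T + 1 - 1)) (x (T + 1 - 1))"
        by (rule window_cost_change_start[OF metric])
          (use xX zX zX[of T] terminated in \<open>auto simp: R_def z_def\<close>)
      \<comment> \<open>This \<open>B\<close> completes \<open>(2 * real I - 1) * B\<close> to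
        \<open>2 * B * real I\<close>.\<close>
      moreover have "d (z T) (x T) \<le> B" using diam zX xX terminated by simp
      moreover have "total_cost f d \<theta> T z = total_cost f d \<theta> T y"
        unfolding window_cost_def z_def by (intro sum.cong) auto
      ultimately show ?thesis using later[unfolded split] by (simp add: algebra_simps)
    qed
  qed
  \<comment> \<open>A uniform lower bound passes to the infimum over a nonempty set; the constant
    trajectory at \<open>x 0\<close> is a member.\<close>
  then have "total_cost f d \<theta> T x - 2 * B * real I \<le> opt_cost X f d \<theta> (x 0) T"
    unfolding opt_cost_def using initial
    by (intro cINF_greatest) (auto intro!: exI[of _ "\<lambda>_. x 0"])
  then show ?thesis unfolding regret_def by simp
qed

end
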